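(* Let $A=(A_1,A_2)$ be a commuting $2$-contraction on a complex Hilbert space $\mathcal{H}$ such that $D_{A^*}$ is one to one, and let $(z_1,z_2)\in\mathbb{D}^2$. Assume that the equation $(\theta_A(z_1,z_2))^*D_{A^*}(y)=0$ admits at least one nontrivial (i.e. nonzero) solution $y\in\mathcal{H}$. Then $(z_1,z_2)\in\sigma_T^{(3)}(A_1,A_2)$.
   Context: $\mathbb{D}^2=\{(z_1,z_2)\in\mathbb{C}^2: |z_1|^2+|z_2|^2<1\}$. A pair $A=(A_1,A_2)$ of bounded operators on $\mathcal{H}$ is a commuting $2$-contraction if $A_1A_2=A_2A_1$ and $\|A_1h_1+A_2h_2\|^2\le\|h_1\|^2+\|h_2\|^2$ for all $h_1,h_2\in\mathcal{H}$ (equivalently $A_1A_1^*+A_2A_2^*\le 1_{\mathcal{H}}$). $A$ is also regarded as the operator $A:\mathcal{H}^2\to\mathcal{H}$, $A(h_1,h_2)=A_1h_1+A_2h_2$, with adjoint $A^*h=(A_1^*h,A_2^*h)$. $D_{A^*}=(1_{\mathcal{H}}-AA^* )^{1/2}=(1_{\mathcal{H}}-A_1A_1^*-A_2A_2^* )^{1/2}$ on $\mathcal{H}$ and $D_A=(1_{\mathcal{H}^2}-A^*A)^{1/2}$ on $\mathcal{H}^2$; $\mathcal{D}_{A^*}$ and $\mathcal{D}_A$ are the closures of the ranges of $D_{A^*}$ and $D_A$. The characteristic function of $A$ is $\theta_A:\mathbb{D}^2\to B(\mathcal{D}_A,\mathcal{D}_{A^*})$, $$\theta_A(z_1,z_2)=-A+D_{A^*}(1_{\mathcal{H}}-z_1A_1^*-z_2A_2^*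 )^{-1}(z_1 1_{\mathcal{H}},z_2 1_{\mathcal{H}})D_A$$ (restricted to $\mathcal{D}_A$), where $(z_1 1_{\mathcal{H}},z_2 1_{\mathcal{H}}):\mathcal{H}^2\to\mathcal{H}$ maps $(h_1,h_2)$ to $z_1h_1+z_2h_2$. The adjoint $(\theta_A(z_1,z_2))^*$ maps $\mathcal{D}_{A^*}$ to $\mathcal{D}_A$. $\sigma_T^{(3)}(A_1,A_2)$ is the set of $(z_1,z_2)\in\mathbb{C}^2$ for which there is $y\in\mathcal{H}$ with $y\neq(A_1-z_1)x_1-(A_2-z_2)x_2$ for all $(x_1,x_2)\in\mathcal{H}^2$. *)

theory Defs
  imports "HOL-Analysis.Analysis"
begin

text \<open>
  Complex Hilbert spaces. The norm and the topology are those of the underlying real inner product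
  space, whose inner product is the real part of the complex one; hence
  \<open>norm x = sqrt (Re (cinner x x))\<close>, and definiteness of \<open>cinner\<close> is inherited from
  \<^class>\<open>real_inner\<close>. The complex inner product is linear in its first argument.
\<close>

class complex_hilbert_space = real_inner + complete_space +
  fixes scaleC :: "complex \<Rightarrow> 'a \<Rightarrow> 'a"  (infixr "*\<^sub>C" 75)
    and cinner :: "'a \<Rightarrow> 'a \<Rightarrow> complex"
  assumes scaleC_add_right: "a *\<^sub>C (x + y) = a *\<^sub>C x + a *\<^sub>C y"
    and scaleC_add_left: "(a + b) *\<^sub>C x = a *\<^sub>C x + b *\<^sub>C x"
    and scaleC_scaleC: "a *\<^sub>C b *\<^sub>C x = (a * b) *\<^sub>C x"
    and scaleC_of_real: "complex_of_real r *\<^sub>C x = r *\<^sub>R x"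
    and cinner_commute: "cinner x y = cnj (cinner y x)"
    and cinner_add_left: "cinner (x + y) w = cinner x w + cinner y w"
    and cinner_scaleC_left: "cinner (a *\<^sub>C x) y = a * cinner x y"
    and inner_eq_Re_cinner: "inner x y = Re (cinner x y)"

instantiation prod :: (complex_hilbert_space, complex_hilbert_space) complex_hilbert_space
begin

definition scaleC_prod_def: "a *\<^sub>C x = (a *\<^sub>C fst x, a *\<^sub>C snd x)"

definition cinner_prod_def: "cinner x y = cinner (fst x) (fst y) + cinner (snd x) (snd y)"

instance
proof
  fix x y w :: "'a \<times> 'b" and a b :: complex and r :: real
  show "a *\<^sub>C (x + y) = a *\<^sub>C x + a *\<^sub>C y"
    by (simp add: scaleC_prod_def scaleC_add_right)
  show "(a + b) *\<^sub>C x = a *\<^sub>C x + b *\<^sub>C x"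
    by (simp add: scaleC_prod_def scaleC_add_left)
  show "a *\<^sub>C b *\<^sub>C x = (a * b) *\<^sub>C x"
    by (simp add: scaleC_prod_def scaleC_scaleC)
  show "complex_of_real r *\<^sub>C x = r *\<^sub>R x"
    by (simp add: scaleC_prod_def scaleC_of_real scaleR_prod_def)
  show "cinner x y = cnj (cinner y x)"
    unfolding cinner_prod_def complex_cnj_add by (metis cinner_commute)
  show "cinner (x + y) w = cinner x w + cinner y w"
    by (simp add: cinner_prod_def cinner_add_left)
  show "cinner (a *\<^sub>C x) y = a * cinner x y"
    by (simp add: cinner_prod_def scaleC_prod_def cinner_scaleC_left distrib_left)
  show "inner x y = Re (cinner x y)"
    by (simp add: cinner_prod_def inner_prod_def inner_eq_Re_cinner)
qed

end

definition bounded_clinear ::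
    "('a::complex_hilbert_space \<Rightarrow> 'b::complex_hilbert_space) \<Rightarrow> bool" where
  "bounded_clinear T \<longleftrightarrow> bounded_linear T \<and> (\<forall>c x. T (c *\<^sub>C x) = c *\<^sub>C T x)"

text \<open>
  The Hilbert space adjoint \<open>N \<rightarrow> M\<close> of an operator \<open>T: M \<rightarrow> N\<close> between closed complex subspaces
  \<open>M\<close> and \<open>N\<close>; only the values of \<open>T\<close> on \<open>M\<close> matter.
\<close>

definition adjoint_on ::
    "'a::complex_hilbert_space set \<Rightarrow> 'b::complex_hilbert_space set \<Rightarrow> ('a \<Rightarrow> 'b) \<Rightarrow> 'b \<Rightarrow> 'a" where
  "adjoint_on M N T =
     (\<lambda>y\<in>N. THE x. x \<in> M \<and> (\<forall>m\<in>M. cinner (T m) y = cinner m x))"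

definition cadjoint ::
    "('a::complex_hilbert_space \<Rightarrow> 'b::complex_hilbert_space) \<Rightarrow> 'b \<Rightarrow> 'a" where
  "cadjoint T = adjoint_on UNIV UNIV T"

definition positive_op :: "('a::complex_hilbert_space \<Rightarrow> 'a) \<Rightarrow> bool" where
  "positive_op T \<longleftrightarrow> bounded_clinear T \<and> (\<forall>x. cinner (T x) x \<in> \<real>\<^sub>\<ge>\<^sub>0)"

definition sqrt_op :: "('a::complex_hilbert_space \<Rightarrow> 'a) \<Rightarrow> 'a \<Rightarrow> 'a" where
  "sqrt_op T = (THE S. positive_op S \<and> S \<circ> S = T)"

definition commuting_2_contraction :: "('a::complex_hilbert_space \<Rightarrow> 'a) \<Rightarrow> ('a \<Rightarrow> 'a) \<Rightarrow> bool" where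
  "commuting_2_contraction A1 A2 \<longleftrightarrow>
     bounded_clinear A1 \<and> bounded_clinear A2 \<and> A1 \<circ> A2 = A2 \<circ> A1 \<and>
     (\<forall>h1 h2. (norm (A1 h1 + A2 h2))\<^sup>2 \<le> (norm h1)\<^sup>2 + (norm h2)\<^sup>2)"

definition row_op :: "('a::complex_hilbert_space \<Rightarrow> 'a) \<Rightarrow> ('a \<Rightarrow> 'a) \<Rightarrow> 'a \<times> 'a \<Rightarrow> 'a" where
  "row_op A1 A2 = (\<lambda>(h1, h2). A1 h1 + A2 h2)"

text \<open>
  For \<open>A = row_op A1 A2\<close>, the operators \<open>D\<^sub>A\<close> and \<open>D\<^sub>A\<^sub>*\<close> are \<open>defect A1 A2\<close> and
  \<open>defect_star A1 A2\<close>.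
\<close>

definition defect :: "('a::complex_hilbert_space \<Rightarrow> 'a) \<Rightarrow> ('a \<Rightarrow> 'a) \<Rightarrow> 'a \<times> 'a \<Rightarrow> 'a \<times> 'a" where
  "defect A1 A2 = sqrt_op (\<lambda>h. h - cadjoint (row_op A1 A2) (row_op A1 A2 h))"

definition defect_star :: "('a::complex_hilbert_space \<Rightarrow> 'a) \<Rightarrow> ('a \<Rightarrow> 'a) \<Rightarrow> 'a \<Rightarrow> 'a" where
  "defect_star A1 A2 = sqrt_op (\<lambda>h. h - row_op A1 A2 (cadjoint (row_op A1 A2) h))"

definition defect_space :: "('a::complex_hilbert_space \<Rightarrow> 'a) \<Rightarrow> ('a \<Rightarrow> 'a) \<Rightarrow> ('a \<times> 'a) set" where
  "defect_space A1 A2 = closure (range (defect A1 A2))"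

definition defect_star_space :: "('a::complex_hilbert_space \<Rightarrow> 'a) \<Rightarrow> ('a \<Rightarrow> 'a) \<Rightarrow> 'a set" where
  "defect_star_space A1 A2 = closure (range (defect_star A1 A2))"

definition unit_ball2 :: "(complex \<times> complex) set" where
  "unit_ball2 = {(z1, z2). (cmod z1)\<^sup>2 + (cmod z2)\<^sup>2 < 1}"

definition char_fun ::
    "('a::complex_hilbert_space \<Rightarrow> 'a) \<Rightarrow> ('a \<Rightarrow> 'a) \<Rightarrow> complex \<times> complex \<Rightarrow> 'a \<times> 'a \<Rightarrow> 'a" where
  "char_fun A1 A2 = (\<lambda>(z1, z2). \<lambda>h\<in>defect_space A1 A2.
     - row_op A1 A2 h +
     defect_star A1 A2
       (inv (\<lambda>x. x - z1 *\<^sub>C cadjoint A1 x - z2 *\<^sub>C cadjoint A2 x)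
         (row_op (\<lambda>x. z1 *\<^sub>C x) (\<lambda>x. z2 *\<^sub>C x) (defect A1 A2 h))))"

definition char_fun_adjoint ::
    "('a::complex_hilbert_space \<Rightarrow> 'a) \<Rightarrow> ('a \<Rightarrow> 'a) \<Rightarrow> complex \<times> complex \<Rightarrow> 'a \<Rightarrow> 'a \<times> 'a" where
  "char_fun_adjoint A1 A2 z =
     adjoint_on (defect_space A1 A2) (defect_star_space A1 A2) (char_fun A1 A2 z)"

definition sigma_T3 ::
    "('a::complex_hilbert_space \<Rightarrow> 'a) \<Rightarrow> ('a \<Rightarrow> 'a) \<Rightarrow> (complex \<times> complex) set" where
  "sigma_T3 A1 A2 = {(z1, z2). \<exists>y. \<forall>x1 x2.
     y \<noteq> (A1 x1 - z1 *\<^sub>C x1) - (A2 x2 - z2 *\<^sub>C x2)}"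

end

theory Submission
  imports Defs "HOL-Computational_Algebra.Formal_Power_Series"
begin

text \<open>
  Write \<open>A\<close> for the row operator, \<open>Z = (z\<^sub>1 1, z\<^sub>2 1)\<close> for the scalar row, \<open>D\<close> and \<open>D\<^sub>*\<close> for the
  defect operators on \<open>H\<^sup>2\<close> and on \<open>H\<close>. Since \<open>A\<^sup>* D\<^sub>* = D A\<^sup>*\<close>, the vector \<open>\<theta>(z)\<^sup>* D\<^sub>* y\<close> equals
  \<open>D (Z\<^sup>* u - A\<^sup>* y)\<close>, where \<open>u\<close> solves \<open>(1 - A Z\<^sup>*) u = (1 - A A\<^sup>*) y\<close>
  (\<open>char_fun_adjoint_defect_star\<close>). Injectivity of \<open>D\<^sub>*\<close> passes to \<open>D\<close> (\<open>defect_eq_0\<close>), so if this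
  vector vanishes, then \<open>Z\<^sup>* u = A\<^sup>* y\<close>; putting this into the equation for \<open>u\<close> gives \<open>u = y\<close>. Hence
  \<open>A\<^sup>* y = Z\<^sup>* y\<close>: the vector \<open>y\<close> is a joint eigenvector of \<open>A\<^sub>1\<^sup>*\<close>, \<open>A\<^sub>2\<^sup>*\<close> with the conjugate
  eigenvalues. It is therefore orthogonal to the ranges of \<open>A\<^sub>1 - z\<^sub>1\<close> and \<open>A\<^sub>2 - z\<^sub>2\<close>, and a nonzero
  \<open>y\<close> cannot lie in the sum of these ranges.

  The adjoint, the square root and the inverse in the characteristic function are given by
  descriptions, so this computation rests on existence theorems: adjoints come from the Riesz
  representation (\<open>cinner_cadjoint\<close>), inverses from the contraction principle
  (\<open>surj_id_minus_contraction\<close>), and the unique positive square root of \<open>1 - P\<close>, for a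
  self-adjoint contraction \<open>P\<close>, from the binomial series of \<open>(1 - P)\<^bsup>1/2\<^esup>\<close> (\<open>sqrt_op_one_minus\<close>).
  An explicit series makes intertwining relations such as \<open>A\<^sup>* D\<^sub>* = D A\<^sup>*\<close> immediate, because they
  hold for every power (\<open>sqrt_one_minus_intertwine\<close>).
\<close>

section \<open>Complex Hilbert spaces\<close>

instance complex_hilbert_space \<subseteq> banach ..

lemma cinner_scaleC_right: "cinner x (c *\<^sub>C y) = cnj c * cinner x y"
proof -
  have "cinner x (c *\<^sub>C y) = cnj (cinner (c *\<^sub>C y) x)"
    by (rule cinner_commute)
  also have "\<dots> = cnj c * cnj (cinner y x)"
    by (simp add: cinner_scaleC_left)
  also have "\<dots> = cnj c * cinner x y"
    by (simp flip: cinner_commute)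
  finally show ?thesis .
qed

text \<open>
  As the real inner product determines the complex one, identities between complex-linear maps need
  to be checked for \<^const>\<open>inner\<close> only (\<open>cinner_eq_if_inner_eq\<close>).
\<close>

lemma Im_cinner: "Im (cinner x y) = inner x (\<i> *\<^sub>C y)"
  by (simp add: inner_eq_Re_cinner cinner_scaleC_right)

lemma scaleC_0_right [simp]: "c *\<^sub>C (0::'a::complex_hilbert_space) = 0"
  using scaleC_add_right[of c "0::'a" 0] by simp

lemma scaleC_one [simp]: "1 *\<^sub>C x = (x::'a::complex_hilbert_space)"
  using scaleC_of_real[of 1 x] by simp

lemma scaleC_minus_one: "(-1) *\<^sub>C x = - (x::'a::complex_hilbert_space)"
  using scaleC_of_real[of "-1" x] by simp

lemma scaleC_minus_right: "c *\<^sub>C (- x) = - (c *\<^sub>C (x::'a::complex_hilbert_space))"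
  using scaleC_add_right[of c x "- x"] by (simp add: eq_neg_iff_add_eq_0 add.commute)

lemma inner_scaleC_left: "inner (c *\<^sub>C x) y = inner x (cnj c *\<^sub>C y)"
  by (simp add: inner_eq_Re_cinner cinner_scaleC_left cinner_scaleC_right)

lemma cinner_diff_left: "cinner (x - y) w = cinner x w - cinner y w"
  using cinner_add_left[of "x - y" y w] by simp

lemma cinner_diff_right: "cinner x (y - w) = cinner x y - cinner x w"
proof -
  have "cnj (cinner (y - w) x) = cnj (cinner y x) - cnj (cinner w x)"
    by (simp add: cinner_diff_left)
  then show ?thesis
    by (simp flip: cinner_commute)
qed

lemma norm_scaleC: "norm (c *\<^sub>C x) = cmod c * norm (x::'a::complex_hilbert_space)"
proof -
  have "(norm (c *\<^sub>C x))\<^sup>2 = inner x ((cnj c * c) *\<^sub>C x)"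
    by (simp add: power2_norm_eq_inner inner_scaleC_left scaleC_scaleC)
  also have "\<dots> = (cmod c * norm x)\<^sup>2"
    by (simp add: complex_norm_square[symmetric] mult.commute scaleC_of_real power_mult_distrib
        power2_norm_eq_inner flip: of_real_power)
  finally show ?thesis
    by (simp add: power2_eq_iff_nonneg)
qed

lemma bounded_clinear_scaleC: "bounded_clinear (\<lambda>x::'a::complex_hilbert_space. c *\<^sub>C x)"
  unfolding bounded_clinear_def
proof (intro conjI allI)
  show "bounded_linear (\<lambda>x::'a. c *\<^sub>C x)"
    by (rule bounded_linear_intro[where K = "cmod c"])
       (simp_all add: scaleC_add_right norm_scaleC scaleC_scaleC mult.commute flip: scaleC_of_real)
qed (simp add: scaleC_scaleC mult.commute)

lemma bounded_clinear_compose: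
  "bounded_clinear S \<Longrightarrow> bounded_clinear T \<Longrightarrow> bounded_clinear (\<lambda>x. S (T x))"
  by (simp add: bounded_clinear_def bounded_linear_compose)

lemma bounded_clinear_add:
  "bounded_clinear S \<Longrightarrow> bounded_clinear T \<Longrightarrow> bounded_clinear (\<lambda>x. S x + T x)"
  by (simp add: bounded_clinear_def bounded_linear_add scaleC_add_right)

section \<open>The Riesz representation and adjoints\<close>

text \<open>
  The variational principle behind both the Riesz representation and \<open>positive_op_eq_0\<close>: a
  quadratic that is minimal at \<open>0\<close> has no linear term.
\<close>

lemma linear_coeff_zero:
  fixes a b :: real
  assumes "\<And>t. 0 \<le> t * a + t\<^sup>2 * b"
  shows "a = 0"
proof (rule ccontr)
  assume "a \<noteq> 0"
  \<comment> \<open>Step against the sign of \<open>a\<close>, so short that the quadratic term cannot compensate.\<close>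
  define s where "s = - a / (\<bar>b\<bar> + 1)"
  have "s * a + s\<^sup>2 * b \<le> s * a + s\<^sup>2 * \<bar>b\<bar>"
    by (simp add: mult_left_mono)
  also have "\<dots> = - (a\<^sup>2 / (\<bar>b\<bar> + 1)\<^sup>2)"
    by (simp add: s_def power2_eq_square divide_simps) (simp add: algebra_simps)
  also have "\<dots> < 0"
    using \<open>a \<noteq> 0\<close> by (auto simp: add_nonneg_eq_0_iff)
  finally show False
    using assms[of s] by simp
qed

text \<open>
  The representing vector is the minimiser of \<open>J x = \<parallel>x\<parallel>\<^sup>2 - 2 f x\<close>. The parallelogram law bounds
  \<open>\<parallel>x - y\<parallel>\<^sup>2\<close> by the excess of \<open>J x\<close> and \<open>J y\<close> over the infimum, so a minimising sequence converges,
  and the first variation of \<open>J\<close> vanishes at its limit.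
\<close>

lemma riesz_representation:
  fixes f :: "'a::{real_inner,complete_space} \<Rightarrow> real"
  assumes "bounded_linear f"
  shows "\<exists>p. \<forall>h. f h = inner h p"
proof -
  interpret f: bounded_linear f by fact
  define J where "J x = (norm x)\<^sup>2 - 2 * f x" for x
  obtain K where K: "\<And>x. norm (f x) \<le> norm x * K"
    using f.bounded by blast
  have "J x \<ge> - K\<^sup>2" for x
  proof -
    have "f x \<le> norm x * K" using K[of x] by simp
    moreover have "0 \<le> (norm x - K)\<^sup>2" by simp
    ultimately show ?thesis by (simp add: J_def power2_diff)
  qed
  then have bdd: "bdd_below (range J)"
    by (rule bdd_belowI2)
  define m where "m = Inf (range J)"
  have m_le: "m \<le> J x" for x
    unfolding m_def using bdd by (rule cINF_lower) simp
  have "\<exists>x. J x < m + e" if "e > 0" for e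
    using cINF_less_iff[OF _ bdd, of "m + e"] that by (auto simp: m_def)
  then have "\<forall>n. \<exists>x. J x < m + 1 / real (Suc n)"
    by simp
  then obtain X where X: "\<And>n. J (X n) < m + 1 / real (Suc n)"
    by metis
  have para: "(norm (x - y))\<^sup>2 \<le> 2 * (J x - m) + 2 * (J y - m)" for x y
  proof -
    have "(norm (x - y))\<^sup>2 = 2 * J x + 2 * J y - 4 * J ((1/2) *\<^sub>R (x + y))"
      by (simp add: J_def power2_norm_eq_inner f.scaleR f.add algebra_simps inner_commute)
    then show ?thesis using m_le[of "(1/2) *\<^sub>R (x + y)"] by simp
  qed
  have "Cauchy X"
  proof (rule CauchyI)
    fix e :: real assume "e > 0"
    then obtain N where N: "1 / real (Suc N) < e\<^sup>2 / 4"
      using reals_Archimedean[of "e\<^sup>2 / 4"] by (auto simp: inverse_eq_divide)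
    show "\<exists>M. \<forall>k\<ge>M. \<forall>n\<ge>M. norm (X k - X n) < e"
    proof (intro exI allI impI)
      fix k n assume "k \<ge> N" "n \<ge> N"
      then have "1 / real (Suc k) \<le> 1 / real (Suc N)" "1 / real (Suc n) \<le> 1 / real (Suc N)"
        by (simp_all add: frac_le)
      then have "J (X k) - m < e\<^sup>2 / 4" "J (X n) - m < e\<^sup>2 / 4"
        using X[of k] X[of n] N by argo+
      then have "(norm (X k - X n))\<^sup>2 < e\<^sup>2"
        using para[of "X k" "X n"] by argo
      then show "norm (X k - X n) < e"
        using \<open>e > 0\<close> by (simp add: power2_less_imp_less)
    qed
  qed
  then obtain p where p: "X \<longlonglongrightarrow> p"
    using Cauchy_convergent_iff convergent_def by blast
  have "(\<lambda>n. J (X n)) \<longlonglongrightarrow> J p"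
    unfolding J_def by (intro tendsto_intros p f.tendsto)
  moreover have "(\<lambda>n. m + 1 / real (Suc n)) \<longlonglongrightarrow> m + 0"
    by (intro tendsto_intros LIMSEQ_Suc[OF lim_1_over_n])
  ultimately have "J p \<le> m + 0"
    by (rule LIMSEQ_le) (use X less_imp_le in blast)
  have "f h = inner h p" for h
  proof -
    have "2 * (inner h p - f h) = 0"
    proof (rule linear_coeff_zero)
      fix t
      have "J p \<le> J (p + t *\<^sub>R h)"
        using \<open>J p \<le> m + 0\<close> m_le[of "p + t *\<^sub>R h"] by simp
      then show "0 \<le> t * (2 * (inner h p - f h)) + t\<^sup>2 * inner h h"
        by (simp add: J_def power2_norm_eq_inner f.scaleR f.add algebra_simps inner_commute
            power2_eq_square[of t])
    qed
    then show ?thesis by simp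
  qed
  then show ?thesis by blast
qed

lemma cinner_eq_if_inner_eq:
  assumes S: "\<And>c x. S (c *\<^sub>C x) = c *\<^sub>C S x"
    and eq: "\<And>x y. inner (T x) y = inner x (S y)"
  shows "cinner (T x) y = cinner x (S y)"
  by (simp add: complex_eq_iff Im_cinner eq S flip: inner_eq_Re_cinner)

text \<open>
  Riesz provides an adjoint for the real inner product; replacing \<open>m\<close> by \<open>-\<i> m\<close> shows that the same
  vector serves for the imaginary part.
\<close>

lemma cinner_cadjoint:
  assumes "bounded_clinear T"
  shows "cinner (T x) y = cinner x (cadjoint T y)"
proof -
  interpret T: bounded_linear T
    using assms by (simp add: bounded_clinear_def)
  have "\<exists>p. \<forall>m. inner (T m) y = inner m p"
    by (intro riesz_representation bounded_linear_inner_left_comp T.bounded_linear_axioms)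
  then obtain p where p: "\<And>m. inner (T m) y = inner m p" by blast
  have p': "cinner (T m) y = cinner m p" for m
  proof -
    have "T (- \<i> *\<^sub>C m) = - \<i> *\<^sub>C T m"
      using assms by (simp add: bounded_clinear_def)
    then show ?thesis
      using p[of m] p[of "- \<i> *\<^sub>C m"]
      by (simp add: complex_eq_iff Im_cinner inner_scaleC_left flip: inner_eq_Re_cinner)
  qed
  have "cadjoint T y = (THE x. \<forall>m. cinner (T m) y = cinner m x)"
    by (simp add: cadjoint_def adjoint_on_def)
  also have "\<dots> = p"
  proof (rule the_equality)
    fix q assume "\<forall>m. cinner (T m) y = cinner m q"
    then have "inner m q = inner m p" for m
      by (metis p' inner_eq_Re_cinner)
    then show "q = p"
      by (metis inner_commute vector_eq_rdot)
  qed (use p' in blast)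
  finally show ?thesis using p' by simp
qed

lemma inner_cadjoint: "bounded_clinear T \<Longrightarrow> inner (T x) y = inner x (cadjoint T y)"
  by (simp add: inner_eq_Re_cinner cinner_cadjoint)

lemma norm_cadjoint_le:
  assumes T: "bounded_clinear T" and "0 \<le> c" and c: "\<And>x. norm (T x) \<le> c * norm x"
  shows "norm (cadjoint T y) \<le> c * norm y"
proof (cases "cadjoint T y = 0")
  case True
  then show ?thesis using \<open>0 \<le> c\<close> by simp
next
  case False
  let ?u = "cadjoint T y"
  have "norm ?u * norm ?u = inner (T ?u) y"
    by (simp add: inner_cadjoint[OF T] flip: power2_norm_eq_inner power2_eq_square)
  also have "\<dots> \<le> norm (T ?u) * norm y"
    by (rule norm_cauchy_schwarz)
  also have "\<dots> \<le> norm ?u * (c * norm y)"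
    using mult_right_mono[OF c[of ?u], of "norm y"] by (simp add: ac_simps)
  finally show ?thesis
    using False by simp
qed

lemma bounded_clinear_cadjoint:
  assumes T: "bounded_clinear T"
  shows "bounded_clinear (cadjoint T)"
proof -
  have eqI: "u = v" if "\<And>m. inner m u = inner m v" for u v :: 'a
    using that by (metis inner_commute vector_eq_rdot)
  have add: "cadjoint T (x + y) = cadjoint T x + cadjoint T y" for x y
    by (rule eqI) (simp add: inner_add_right flip: inner_cadjoint[OF T])
  have Tc: "T (c *\<^sub>C x) = c *\<^sub>C T x" for c x
    using T by (simp add: bounded_clinear_def)
  have scale: "cadjoint T (c *\<^sub>C y) = c *\<^sub>C cadjoint T y" for c y
  proof (rule eqI)
    fix m
    have "inner m (cadjoint T (c *\<^sub>C y)) = inner (T (cnj c *\<^sub>C m)) y"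
      by (simp add: inner_cadjoint[OF T, symmetric] inner_scaleC_left Tc)
    also have "\<dots> = inner m (c *\<^sub>C cadjoint T y)"
      by (simp add: inner_cadjoint[OF T] inner_scaleC_left)
    finally show "inner m (cadjoint T (c *\<^sub>C y)) = inner m (c *\<^sub>C cadjoint T y)" .
  qed
  obtain K where "0 \<le> K" "\<And>x. norm (T x) \<le> norm x * K"
    using T bounded_linear.nonneg_bounded unfolding bounded_clinear_def by blast
  then have "norm (cadjoint T y) \<le> norm y * K" for y
    using norm_cadjoint_le[OF T, of K] by (simp add: mult.commute)
  then have "bounded_linear (cadjoint T)"
    by (intro bounded_linear_intro[where K = K] add) (simp_all add: scale flip: scaleC_of_real)
  then show ?thesis
    by (simp add: bounded_clinear_def scale)
qed

section \<open>Positive square roots\<close>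

text \<open>
  Polarisation: \<open>\<langle>S x, x\<rangle>\<close> is real for every \<open>x\<close>, and the imaginary parts of the mixed terms for
  \<open>x\<close> and \<open>\<i> y\<close> express symmetry.
\<close>

lemma positive_op_self_adjoint:
  assumes "positive_op S"
  shows "inner (S x) y = inner x (S y)"
proof -
  interpret S: bounded_linear S
    using assms by (simp add: positive_op_def bounded_clinear_def)
  have SC: "S (c *\<^sub>C x) = c *\<^sub>C S x" for c x
    using assms by (simp add: positive_op_def bounded_clinear_def)
  have "Im (cinner (S x) x) = 0" for x
    using assms by (simp add: positive_op_def complex_nonneg_Reals_iff)
  then have diag: "inner (S x) (\<i> *\<^sub>C x) = 0" for x
    by (simp add: Im_cinner)
  have "inner (S u) (\<i> *\<^sub>C v) + inner (S v) (\<i> *\<^sub>C u) = 0" for u v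
    using diag[of "u + v"] diag[of u] diag[of v]
    by (simp add: S.add scaleC_add_right inner_add_left inner_add_right)
  from this[of x "\<i> *\<^sub>C y"] show ?thesis
    by (simp add: SC inner_scaleC_left scaleC_scaleC scaleC_minus_one inner_commute)
qed

lemma positive_op_cinner:
  assumes "positive_op S"
  shows "cinner (S x) y = cinner x (S y)"
  using assms
  by (intro cinner_eq_if_inner_eq positive_op_self_adjoint)
     (auto simp: positive_op_def bounded_clinear_def)

lemma positive_op_inner_nonneg: "positive_op S \<Longrightarrow> inner (S x) x \<ge> 0"
  by (simp add: positive_op_def inner_eq_Re_cinner complex_nonneg_Reals_iff)

text \<open>
  The form \<open>\<langle>S v, v\<rangle>\<close> is nonnegative and vanishes at \<open>x\<close>; its derivative there in the direction
  \<open>S x\<close> is \<open>2 \<parallel>S x\<parallel>\<^sup>2\<close>.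
\<close>

lemma positive_op_eq_0:
  assumes S: "positive_op S" and 0: "inner (S x) x = 0"
  shows "S x = 0"
proof -
  interpret S: bounded_linear S
    using assms by (simp add: positive_op_def bounded_clinear_def)
  have "2 * inner (S x) (S x) = 0"
  proof (rule linear_coeff_zero)
    fix t
    have "inner (S (x + t *\<^sub>R S x)) (x + t *\<^sub>R S x) \<ge> 0"
      by (rule positive_op_inner_nonneg[OF S])
    then show "0 \<le> t * (2 * inner (S x) (S x)) + t\<^sup>2 * inner (S (S x)) (S x)"
      using 0 positive_op_self_adjoint[OF S, of "S x" x]
      by (simp add: S.add S.scaleR inner_add_left inner_add_right power2_eq_square algebra_simps)
  qed
  then show ?thesis by simp
qed

text \<open>
  The Taylor coefficients of \<open>(1 - t)\<^bsup>1/2\<^esup>\<close> at \<open>0\<close>.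
\<close>

definition sqrt_coeff :: "nat \<Rightarrow> real" where
  "sqrt_coeff n = (1/2 gchoose n) * (-1) ^ n"

lemma sqrt_coeff_0 [simp]: "sqrt_coeff 0 = 1"
  by (simp add: sqrt_coeff_def)

text \<open>
  The partial sums telescope to the Taylor coefficients of \<open>(1 - t)\<^bsup>-1/2\<^esup>\<close>, which are positive. As
  only the constant coefficient of \<open>(1 - t)\<^bsup>1/2\<^esup>\<close> is positive, this gives absolute convergence at
  the boundary point \<open>t = 1\<close>, and hence at contractions.
\<close>

lemma sqrt_coeff_partial_sum_nonneg: "0 \<le> (\<Sum>k\<le>n. sqrt_coeff k)"
proof -
  have "(\<Sum>k\<le>n. sqrt_coeff k) = (-1) ^ n * (-1/2 gchoose n)"
    unfolding sqrt_coeff_def by (subst gbinomial_sum_lower_neg) simp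
  also have "\<dots> = pochhammer (1/2) n / fact n"
    by (simp add: gbinomial_pochhammer flip: power_mult_distrib mult.assoc)
  also have "\<dots> \<ge> 0"
    by (simp add: pochhammer_nonneg)
  finally show ?thesis .
qed

lemma sqrt_coeff_nonpos:
  assumes "n > 0"
  shows "sqrt_coeff n \<le> 0"
proof -
  obtain k where n: "n = Suc k" using assms gr0_conv_Suc by auto
  have "sqrt_coeff n = (1/2 / real n) * (-1) ^ n * (-1/2 gchoose k)"
    unfolding sqrt_coeff_def using gbinomial_absorption'[OF assms, of "1/2::real"] by (simp add: n)
  also have "\<dots> = - ((1/2 / real n) * (pochhammer (1/2) k / fact k))"
    by (simp add: n gbinomial_pochhammer flip: power_mult_distrib)
  also have "\<dots> \<le> 0"
    by (simp add: pochhammer_nonneg)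
  finally show ?thesis .
qed

lemma abs_summable_sqrt_coeff: "summable (\<lambda>n. \<bar>sqrt_coeff n\<bar>)"
proof (rule bounded_imp_summable)
  fix n
  \<comment> \<open>Only the sign of the constant coefficient \<open>1\<close> has to be corrected.\<close>
  have "(\<Sum>k\<le>n. \<bar>sqrt_coeff k\<bar>) = (\<Sum>k\<le>n. (if k = 0 then 2 else 0) - sqrt_coeff k)"
    using sqrt_coeff_nonpos by (intro sum.cong) auto
  also have "\<dots> \<le> 2"
    using sqrt_coeff_partial_sum_nonneg[of n] by (simp add: sum_subtractf)
  finally show "(\<Sum>k\<le>n. \<bar>sqrt_coeff k\<bar>) \<le> 2" .
qed simp

lemma suminf_sqrt_coeff_nonneg: "0 \<le> (\<Sum>n. sqrt_coeff n)"
proof -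
  have "summable sqrt_coeff"
    using abs_summable_sqrt_coeff summable_rabs_cancel by blast
  then have "(\<lambda>n. \<Sum>k\<le>n. sqrt_coeff k) \<longlonglongrightarrow> (\<Sum>n. sqrt_coeff n)"
    by (rule summable_LIMSEQ')
  then show ?thesis
    by (rule LIMSEQ_le_const) (use sqrt_coeff_partial_sum_nonneg in blast)
qed

text \<open>
  The identity \<open>((1 - t)\<^bsup>1/2\<^esup>)\<^sup>2 = 1 - t\<close> on coefficients, an instance of Vandermonde convolution.
\<close>

lemma sqrt_coeff_convolution:
  "(\<Sum>i\<le>n. sqrt_coeff i * sqrt_coeff (n - i)) = (if n = 0 then 1 else if n = 1 then -1 else 0)"
proof -
  have "(\<Sum>i\<le>n. sqrt_coeff i * sqrt_coeff (n - i))
      = (\<Sum>i\<le>n. (-1) ^ n * ((1/2 gchoose i) * (1/2 gchoose (n - i))))"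
    by (intro sum.cong) (auto simp: sqrt_coeff_def simp flip: power_add)
  also have "\<dots> = (-1) ^ n * ((1/2 + 1/2) gchoose n)"
    by (simp only: gbinomial_Vandermonde[symmetric] sum_distrib_left atMost_atLeast0)
  also have "\<dots> = (-1) ^ n * real (1 choose n)"
    by (simp add: binomial_gbinomial)
  finally show ?thesis
    by (cases n rule: nat.exhaust) (auto simp: binomial_eq_0)
qed

text \<open>
  A Cauchy product for the action of a power series on an orbit \<open>g n = P\<^sup>n x\<close>. All factors but one are
  scalars, so no multiplication on the Banach space is involved; the double series converges
  absolutely and is summed along antidiagonals.
\<close>

lemma suminf_Cauchy_convolution:
  fixes c :: "nat \<Rightarrow> real" and g :: "nat \<Rightarrow> 'a::banach"
  assumes c: "summable (\<lambda>n. \<bar>c n\<bar>)" and g: "\<And>n. norm (g n) \<le> K"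
  shows "(\<lambda>k. (\<Sum>i\<le>k. c i * c (k - i)) *\<^sub>R g k) sums (\<Sum>n. c n *\<^sub>R (\<Sum>m. c m *\<^sub>R g (n + m)))"
proof -
  define F where "F = (\<lambda>(n, m). (c n * c m) *\<^sub>R g (n + m))"
  have c': "(\<lambda>n. \<bar>c n\<bar>) summable_on UNIV"
    using c by (simp add: summable_on_UNIV_nonneg_real_iff)
  have "(\<lambda>p. norm (case p of (n, m) \<Rightarrow> c n * c m)) summable_on UNIV \<times> UNIV"
    by (rule iffD2[OF Infinite_Sum.abs_summable_on_Sigma_iff])
       (auto simp: abs_mult infsum_cmult_right' intro!: summable_on_cmult_right summable_on_cmult_left c')
  then have "(\<lambda>p. \<bar>c (fst p)\<bar> * \<bar>c (snd p)\<bar>) summable_on UNIV \<times> UNIV"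
    by (simp add: case_prod_beta abs_mult)
  then have "(\<lambda>p. \<bar>c (fst p)\<bar> * \<bar>c (snd p)\<bar> * K) summable_on UNIV \<times> UNIV"
    by (rule summable_on_cmult_left)
  then have "(\<lambda>p. norm (F p)) summable_on UNIV \<times> UNIV"
    by (rule Infinite_Sum.abs_summable_on_comparison_test')
       (auto simp: F_def abs_mult intro!: mult_left_mono g)
  then have F: "F summable_on UNIV \<times> UNIV"
    by (rule Infinite_Sum.abs_summable_summable)
  then obtain s where s: "(F has_sum s) (UNIV \<times> UNIV)"
    by (auto simp: summable_on_def)
  have inner: "((\<lambda>m. F (n, m)) has_sum c n *\<^sub>R (\<Sum>m. c m *\<^sub>R g (n + m))) UNIV" for n
  proof -
    have sm: "summable (\<lambda>m. norm (c m *\<^sub>R g (n + m)))"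
      by (rule summable_comparison_test'[OF summable_mult2[OF c, of K], of 0])
         (auto intro!: mult_left_mono g)
    have "((\<lambda>m. c m *\<^sub>R g (n + m)) has_sum (\<Sum>m. c m *\<^sub>R g (n + m))) UNIV"
      by (rule norm_summable_imp_has_sum[OF sm summable_sums[OF summable_norm_cancel[OF sm]]])
    from has_sum_scaleR[OF this, of "c n"] show ?thesis
      by (simp add: F_def)
  qed
  have "((\<lambda>n. c n *\<^sub>R (\<Sum>m. c m *\<^sub>R g (n + m))) has_sum s) UNIV"
    by (rule has_sum_SigmaD[OF s]) (rule inner)
  then have s1: "s = (\<Sum>n. c n *\<^sub>R (\<Sum>m. c m *\<^sub>R g (n + m)))"
    by (intro sums_unique has_sum_imp_sums)
  have "((\<lambda>(k, i). F (i, k - i)) has_sum s) (Sigma UNIV (\<lambda>k. {..k}))"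
    using s by (subst has_sum_reindex_bij_witness[where S = "Sigma UNIV (\<lambda>k. {..k})"
        and T = "UNIV \<times> UNIV" and j = "\<lambda>(k, i). (i, k - i)" and i = "\<lambda>(n, m). (n + m, n)" and h = F])
       auto
  then have "((\<lambda>k. (\<Sum>i\<le>k. c i * c (k - i)) *\<^sub>R g k) has_sum s) UNIV"
    by (rule has_sum_SigmaD) (auto simp: F_def scaleR_sum_left intro!: has_sum_finiteI)
  then show ?thesis
    unfolding s1 by (rule has_sum_imp_sums)
qed

definition sqrt_one_minus :: "('a::complex_hilbert_space \<Rightarrow> 'a) \<Rightarrow> 'a \<Rightarrow> 'a" where
  "sqrt_one_minus P x = (\<Sum>n. sqrt_coeff n *\<^sub>R (P ^^ n) x)"

lemma norm_funpow_le:
  fixes P :: "'a::real_normed_vector \<Rightarrow> 'a"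
  assumes "\<And>x. norm (P x) \<le> norm x"
  shows "norm ((P ^^ n) x) \<le> norm x"
  by (induction n) (auto intro: order_trans[OF assms])

lemma summable_sqrt_one_minus:
  fixes P :: "'a::banach \<Rightarrow> 'a"
  assumes "\<And>x. norm (P x) \<le> norm x"
  shows "summable (\<lambda>n. norm (sqrt_coeff n *\<^sub>R (P ^^ n) x))"
  by (rule summable_comparison_test'[OF summable_mult2[OF abs_summable_sqrt_coeff, of "norm x"], of 0])
     (auto intro!: mult_left_mono norm_funpow_le assms)

text \<open>
  It serves in three ways: with \<open>Q = P\<close> it says that whatever commutes with \<open>P\<close> commutes with the square
  root, with scalars \<open>B\<close> it gives complex homogeneity, and with \<open>B = A\<^sup>*\<close> it gives
  \<open>A\<^sup>* (1 - A A\<^sup>*)\<^bsup>1/2\<^esup> = (1 - A\<^sup>* A)\<^bsup>1/2\<^esup> A\<^sup>*\<close>.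
\<close>

lemma sqrt_one_minus_intertwine:
  assumes P: "\<And>x. norm (P x) \<le> norm x"
    and B: "bounded_linear B" and BP: "\<And>x. B (P x) = Q (B x)"
  shows "B (sqrt_one_minus P x) = sqrt_one_minus Q (B x)"
proof -
  interpret B: bounded_linear B by fact
  have pow: "B ((P ^^ n) x) = (Q ^^ n) (B x)" for n
    by (induction n) (simp_all add: BP)
  show ?thesis
    unfolding sqrt_one_minus_def
    by (simp add: B.suminf summable_norm_cancel[OF summable_sqrt_one_minus[OF P]] B.scaleR pow)
qed

locale self_adjoint_contraction =
  fixes P :: "'a::complex_hilbert_space \<Rightarrow> 'a"
  assumes clinear: "bounded_clinear P"
    and contraction: "\<And>x. norm (P x) \<le> norm x"
    and self_adjoint: "\<And>x y. inner (P x) y = inner x (P y)"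
begin

lemmas summable_series = summable_norm_cancel[OF summable_sqrt_one_minus[OF contraction]]

lemma bounded_clinear_sqrt_one_minus: "bounded_clinear (sqrt_one_minus P)"
proof -
  interpret P: bounded_linear P
    using clinear by (simp add: bounded_clinear_def)
  have add_pow: "(P ^^ n) (x + y) = (P ^^ n) x + (P ^^ n) y" for n x y
    by (induction n) (simp_all add: P.add)
  have scale: "sqrt_one_minus P (c *\<^sub>C x) = c *\<^sub>C sqrt_one_minus P x" for c x
    using clinear bounded_clinear_scaleC[of c]
    by (intro sqrt_one_minus_intertwine[symmetric] contraction) (auto simp: bounded_clinear_def)
  have "bounded_linear (sqrt_one_minus P)"
  proof (rule bounded_linear_intro)
    fix x y
    show "sqrt_one_minus P (x + y) = sqrt_one_minus P x + sqrt_one_minus P y"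
      by (simp add: sqrt_one_minus_def add_pow scaleR_add_right suminf_add summable_series)
  next
    fix r x
    show "sqrt_one_minus P (r *\<^sub>R x) = r *\<^sub>R sqrt_one_minus P x"
      using scale[of "of_real r" x] by (simp add: scaleC_of_real)
  next
    fix x
    have "norm (sqrt_one_minus P x) \<le> (\<Sum>n. norm (sqrt_coeff n *\<^sub>R (P ^^ n) x))"
      unfolding sqrt_one_minus_def by (rule summable_norm[OF summable_sqrt_one_minus[OF contraction]])
    also have "\<dots> \<le> (\<Sum>n. \<bar>sqrt_coeff n\<bar> * norm x)"
      by (intro suminf_le summable_sqrt_one_minus contraction summable_mult2 abs_summable_sqrt_coeff)
         (auto intro!: mult_left_mono norm_funpow_le contraction)
    also have "\<dots> = norm x * (\<Sum>n. \<bar>sqrt_coeff n\<bar>)"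
      by (simp add: suminf_mult[OF abs_summable_sqrt_coeff] mult.commute)
    finally show "norm (sqrt_one_minus P x) \<le> norm x * (\<Sum>n. \<bar>sqrt_coeff n\<bar>)" .
  qed
  then show ?thesis
    by (simp add: bounded_clinear_def scale)
qed

lemma inner_sqrt_one_minus:
  "(\<lambda>n. sqrt_coeff n * inner ((P ^^ n) x) y) sums inner (sqrt_one_minus P x) y"
  using bounded_linear.sums[OF bounded_linear_inner_left summable_sums[OF summable_series], of x y]
  by (simp add: sqrt_one_minus_def)

text \<open>
  Since \<open>\<langle>P\<^sup>n x, x\<rangle> \<le> \<parallel>x\<parallel>\<^sup>2\<close> and all coefficients beyond the constant one are nonpositive,
  \<open>\<langle>S x, x\<rangle>\<close> is at least \<open>\<parallel>x\<parallel>\<^sup>2\<close> times the sum of the coefficients, which is nonnegative.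
\<close>

lemma positive_op_sqrt_one_minus: "positive_op (sqrt_one_minus P)"
proof -
  let ?S = "sqrt_one_minus P"
  have pow: "inner ((P ^^ n) x) y = inner x ((P ^^ n) y)" for n x y
    by (induction n arbitrary: x y) (simp_all add: self_adjoint funpow_swap1)
  have "inner (?S x) y = inner x (?S y)" for x y
    using inner_sqrt_one_minus[of x y] inner_sqrt_one_minus[of y x]
    by (metis (no_types, lifting) ext inner_commute pow sums_unique2)
  then have "cinner (?S x) x = cinner x (?S x)" for x
    using bounded_clinear_sqrt_one_minus
    by (intro cinner_eq_if_inner_eq) (auto simp: bounded_clinear_def)
  then have "Im (cinner (?S x) x) = 0" for x
    by (metis cinner_commute cnj.simps(2) equal_neg_zero)
  moreover have "0 \<le> Re (cinner (?S x) x)" for x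
  proof -
    have "sqrt_coeff n * (norm x)\<^sup>2 \<le> sqrt_coeff n * inner ((P ^^ n) x) x" for n
    proof (cases "n = 0")
      case False
      have "inner ((P ^^ n) x) x \<le> norm ((P ^^ n) x) * norm x"
        by (rule norm_cauchy_schwarz)
      also have "\<dots> \<le> (norm x)\<^sup>2"
        by (simp add: power2_eq_square mult_right_mono norm_funpow_le contraction)
      finally show ?thesis
        using False by (simp add: mult_left_mono_neg sqrt_coeff_nonpos)
    qed (simp add: power2_norm_eq_inner)
    then have "(\<Sum>n. sqrt_coeff n) * (norm x)\<^sup>2 \<le> inner (?S x) x"
      using abs_summable_sqrt_coeff summable_rabs_cancel
      by (intro sums_le[OF _ sums_mult2[OF summable_sums] inner_sqrt_one_minus]) auto
    moreover have "0 \<le> (\<Sum>n. sqrt_coeff n) * (norm x)\<^sup>2"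
      by (simp add: suminf_sqrt_coeff_nonneg)
    ultimately show ?thesis by (simp flip: inner_eq_Re_cinner)
  qed
  ultimately show ?thesis
    by (simp add: positive_op_def bounded_clinear_sqrt_one_minus complex_nonneg_Reals_iff)
qed

lemma sqrt_one_minus_square: "sqrt_one_minus P (sqrt_one_minus P x) = x - P x"
proof -
  interpret P: bounded_linear P
    using clinear by (simp add: bounded_clinear_def)
  have "(P ^^ n) (sqrt_one_minus P x) = sqrt_one_minus P ((P ^^ n) x)" for n
    by (induction n)
       (simp_all add: sqrt_one_minus_intertwine[OF contraction P.bounded_linear_axioms refl])
  moreover have pow_add: "(P ^^ m) ((P ^^ n) x) = (P ^^ (n + m)) x" for m n
    by (simp add: funpow_add add.commute[of n m])
  ultimately have "sqrt_one_minus P (sqrt_one_minus P x)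
      = (\<Sum>n. sqrt_coeff n *\<^sub>R (\<Sum>m. sqrt_coeff m *\<^sub>R (P ^^ (n + m)) x))"
    by (subst (1) sqrt_one_minus_def) (simp add: sqrt_one_minus_def pow_add)
  moreover have "(\<lambda>k. (\<Sum>i\<le>k. sqrt_coeff i * sqrt_coeff (k - i)) *\<^sub>R (P ^^ k) x) sums \<dots>"
    by (rule suminf_Cauchy_convolution[OF abs_summable_sqrt_coeff norm_funpow_le[OF contraction]])
  moreover have "(\<lambda>k. (\<Sum>i\<le>k. sqrt_coeff i * sqrt_coeff (k - i)) *\<^sub>R (P ^^ k) x) sums
      (\<Sum>k\<in>{0,1}. (\<Sum>i\<le>k. sqrt_coeff i * sqrt_coeff (k - i)) *\<^sub>R (P ^^ k) x)"
    by (rule sums_finite) (auto simp: sqrt_coeff_convolution split: if_splits)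
  ultimately show ?thesis
    by (simp add: sqrt_coeff_convolution sums_unique2)
qed

text \<open>
  Uniqueness: a positive root \<open>R\<close> commutes with \<open>P = 1 - R\<^sup>2\<close>, hence with the series \<open>S\<close>, so
  \<open>(S + R) (S - R) = S\<^sup>2 - R\<^sup>2 = 0\<close>. Positivity then forces both \<open>S\<close> and \<open>R\<close> to vanish on the range
  of \<open>S - R\<close>, and self-adjointness makes \<open>S - R\<close> itself vanish.
\<close>

lemma sqrt_op_one_minus: "sqrt_op (\<lambda>x. x - P x) = sqrt_one_minus P"
  unfolding sqrt_op_def
proof (rule the_equality)
  show "positive_op (sqrt_one_minus P) \<and> sqrt_one_minus P \<circ> sqrt_one_minus P = (\<lambda>x. x - P x)"
    by (auto simp: positive_op_sqrt_one_minus sqrt_one_minus_square)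
next
  fix R assume R: "positive_op R \<and> R \<circ> R = (\<lambda>x. x - P x)"
  let ?S = "sqrt_one_minus P"
  have RR: "R (R x) = x - P x" for x
    using R by (metis comp_apply)
  interpret R: bounded_linear R
    using R by (simp add: positive_op_def bounded_clinear_def)
  interpret S: bounded_linear ?S
    using bounded_clinear_sqrt_one_minus by (simp add: bounded_clinear_def)
  have "R (P x) = P (R x)" for x
    using RR[of "R x"] RR[of x] by (simp add: R.diff)
  then have RS: "R (?S x) = ?S (R x)" for x
    by (rule sqrt_one_minus_intertwine[OF contraction R.bounded_linear_axioms])
  show "R = ?S"
  proof
    fix x
    define y where "y = ?S x - R x"
    have "?S y + R y = 0"
      by (simp add: y_def S.diff R.diff RS RR sqrt_one_minus_square)
    then have "inner (?S y) y + inner (R y) y = 0"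
      by (metis inner_add_left inner_zero_left)
    moreover have "inner (?S y) y \<ge> 0" "inner (R y) y \<ge> 0"
      using R positive_op_sqrt_one_minus positive_op_inner_nonneg by blast+
    ultimately have "inner (?S y) y = 0" "inner (R y) y = 0"
      by linarith+
    then have "?S y = 0" "R y = 0"
      using R positive_op_sqrt_one_minus positive_op_eq_0 by blast+
    then have "inner (?S x - R x) y = 0"
      using R positive_op_sqrt_one_minus
      by (simp add: inner_diff_left positive_op_self_adjoint)
    then show "R x = ?S x"
      by (simp add: y_def)
  qed
qed

end

section \<open>Defect operators of a row contraction\<close>

lemma contraction_composites:
  fixes T :: "'a::complex_hilbert_space \<Rightarrow> 'b::complex_hilbert_space"
  assumes T: "bounded_clinear T" and c: "\<And>x. norm (T x) \<le> norm x"
  shows "self_adjoint_contraction (\<lambda>x. cadjoint T (T x))"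
    and "self_adjoint_contraction (\<lambda>y. T (cadjoint T y))"
proof -
  note T' = bounded_clinear_cadjoint[OF T]
  have c': "norm (cadjoint T y) \<le> norm y" for y
    using norm_cadjoint_le[OF T, of 1 y] c by simp
  have adj: "inner (cadjoint T y) x = inner y (T x)" for x y
    using inner_cadjoint[OF T, of x y] by (simp add: inner_commute)
  show "self_adjoint_contraction (\<lambda>x. cadjoint T (T x))"
    by unfold_locales (auto intro: bounded_clinear_compose T T' order_trans[OF c' c]
        simp: adj inner_cadjoint[OF T])
  show "self_adjoint_contraction (\<lambda>y. T (cadjoint T y))"
    by unfold_locales (auto intro: bounded_clinear_compose T T' order_trans[OF c c']
        simp: adj inner_cadjoint[OF T])
qed

text \<open>
  A solution of \<open>x - K x = y\<close> is a fixed point of the contraction \<open>x \<mapsto> y + K x\<close>.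
\<close>

lemma surj_id_minus_contraction:
  fixes K :: "'a::complex_hilbert_space \<Rightarrow> 'a"
  assumes K: "bounded_linear K" and c: "0 \<le> c" "c < 1" "\<And>x. norm (K x) \<le> c * norm x"
  shows "surj (\<lambda>x. x - K x)"
proof -
  interpret K: bounded_linear K by fact
  have "\<exists>x. y = x - K x" for y
  proof -
    have "dist (y + K u) (y + K v) \<le> c * dist u v" for u v
      using c(3)[of "u - v"] by (simp add: dist_norm K.diff)
    then obtain x where "y + K x = x"
      using banach_fix_type[OF c(1,2), of "\<lambda>x. y + K x"] by blast
    then show ?thesis by (metis add_diff_cancel_right')
  qed
  then show ?thesis by (auto simp: surj_def)
qed

lemma bounded_clinear_row_op:
  assumes "bounded_clinear A1" "bounded_clinear A2"
  shows "bounded_clinear (row_op A1 A2)"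
proof -
  have "bounded_linear (\<lambda>h. A1 (fst h) + A2 (snd h))"
    using assms unfolding bounded_clinear_def
    by (intro bounded_linear_add) (auto intro: bounded_linear_compose bounded_linear_fst bounded_linear_snd)
  then show ?thesis
    using assms
    by (simp add: bounded_clinear_def row_op_def case_prod_beta' scaleC_prod_def scaleC_add_right)
qed

abbreviation scalar_row :: "complex \<Rightarrow> complex \<Rightarrow> 'a::complex_hilbert_space \<times> 'a \<Rightarrow> 'a" where
  "scalar_row z1 z2 \<equiv> row_op (\<lambda>x. z1 *\<^sub>C x) (\<lambda>x. z2 *\<^sub>C x)"

text \<open>
  The adjoint \<open>Z\<^sup>*\<close> of the scalar row \<open>Z = (z\<^sub>1 1, z\<^sub>2 1)\<close>, see \<open>cinner_scalar_row\<close>.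
\<close>

definition scalar_col :: "complex \<Rightarrow> complex \<Rightarrow> 'a::complex_hilbert_space \<Rightarrow> 'a \<times> 'a" where
  "scalar_col z1 z2 u = (cnj z1 *\<^sub>C u, cnj z2 *\<^sub>C u)"

lemma cinner_scalar_row: "cinner (scalar_row z1 z2 h) u = cinner h (scalar_col z1 z2 u)"
  by (simp add: row_op_def scalar_col_def case_prod_beta cinner_prod_def cinner_add_left
      cinner_scaleC_left cinner_scaleC_right)

text \<open>
  Exhibiting one candidate in \<open>M\<close> suffices: the difference of two candidates is orthogonal to \<open>M\<close>,
  in particular to both of them, and hence to itself.
\<close>

lemma adjoint_on_eqI:
  assumes "y \<in> N" and "x \<in> M"
    and x: "\<And>m. m \<in> M \<Longrightarrow> cinner (T m) y = cinner m x"
  shows "adjoint_on M N T y = x"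
proof -
  have "(THE x. x \<in> M \<and> (\<forall>m\<in>M. cinner (T m) y = cinner m x)) = x"
  proof (rule the_equality)
    fix x' assume x': "x' \<in> M \<and> (\<forall>m\<in>M. cinner (T m) y = cinner m x')"
    have "cinner m (x' - x) = 0" if "m \<in> M" for m
      using x[OF that] x' that by (simp add: cinner_diff_right)
    then have "cinner x' (x' - x) - cinner x (x' - x) = 0"
      using x' \<open>x \<in> M\<close> by simp
    then have "cinner (x' - x) (x' - x) = 0"
      by (simp add: cinner_diff_left)
    then show "x' = x"
      using inner_eq_Re_cinner[of "x' - x" "x' - x"] by simp
  qed (use assms in blast)
  then show ?thesis
    using \<open>y \<in> N\<close> by (simp add: adjoint_on_def)
qed

locale row_contraction =
  fixes A1 A2 :: "'a::complex_hilbert_space \<Rightarrow> 'a"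
  assumes clinear1: "bounded_clinear A1" and clinear2: "bounded_clinear A2"
    and row_contraction: "\<And>h1 h2. (norm (A1 h1 + A2 h2))\<^sup>2 \<le> (norm h1)\<^sup>2 + (norm h2)\<^sup>2"
begin

abbreviation A where "A \<equiv> row_op A1 A2"

abbreviation As where "As \<equiv> cadjoint A"

abbreviation D where "D \<equiv> defect A1 A2"

abbreviation Ds where "Ds \<equiv> defect_star A1 A2"

lemma clinear_A: "bounded_clinear A"
  by (rule bounded_clinear_row_op[OF clinear1 clinear2])

lemma contraction_A: "norm (A h) \<le> norm h"
  using row_contraction[of "fst h" "snd h"]
  by (auto simp: row_op_def norm_prod_def case_prod_beta real_le_rsqrt)

sublocale D: self_adjoint_contraction "\<lambda>h. As (A h)"
  by (rule contraction_composites[OF clinear_A contraction_A])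

sublocale Ds: self_adjoint_contraction "\<lambda>x. A (As x)"
  by (rule contraction_composites[OF clinear_A contraction_A])

lemma defect_eq: "D = sqrt_one_minus (\<lambda>h. As (A h))"
  by (simp add: defect_def D.sqrt_op_one_minus)

lemma defect_star_eq: "Ds = sqrt_one_minus (\<lambda>x. A (As x))"
  by (simp add: defect_star_def Ds.sqrt_op_one_minus)

lemmas positive_op_defect = D.positive_op_sqrt_one_minus[folded defect_eq]

lemmas positive_op_defect_star = Ds.positive_op_sqrt_one_minus[folded defect_star_eq]

lemmas defect_square = D.sqrt_one_minus_square[folded defect_eq]

lemmas defect_star_square = Ds.sqrt_one_minus_square[folded defect_star_eq]

lemma bounded_linear_defect: "bounded_linear D" "bounded_linear Ds"
  using positive_op_defect positive_op_defect_star
  by (simp_all add: positive_op_def bounded_clinear_def)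

lemma bounded_linear_A: "bounded_linear A" "bounded_linear As"
  using clinear_A bounded_clinear_cadjoint[OF clinear_A] by (simp_all add: bounded_clinear_def)

lemma adjoint_defect_star: "As (Ds x) = D (As x)"
  unfolding defect_eq defect_star_eq
  by (rule sqrt_one_minus_intertwine[OF Ds.contraction bounded_linear_A(2) refl])

text \<open>
  If \<open>D w = 0\<close>, then \<open>w = A\<^sup>* A w\<close>, so \<open>(1 - A A\<^sup>*) A w = A (w - A\<^sup>* A w) = 0\<close>. Injectivity of \<open>D\<^sub>*\<close>
  yields \<open>A w = 0\<close>, and therefore \<open>w = A\<^sup>* A w = 0\<close>.
\<close>

lemma defect_eq_0:
  assumes "inj Ds" and "D w = 0"
  shows "w = 0"
proof -
  interpret D: bounded_linear D by (rule bounded_linear_defect)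
  interpret Ds: bounded_linear Ds by (rule bounded_linear_defect)
  interpret A: bounded_linear A by (rule bounded_linear_A)
  interpret As: bounded_linear As by (rule bounded_linear_A)
  have w: "w = As (A w)"
    using defect_square[of w] by (simp add: assms(2) D.zero)
  then have "Ds (Ds (A w)) = Ds (Ds 0)"
    using defect_star_square[of "A w"] by (simp add: Ds.zero)
  then have "A w = 0"
    using assms(1) by (metis injD)
  then show ?thesis
    using w by (simp add: As.zero)
qed

text \<open>
  The operator \<open>A Z\<^sup>*\<close>. Its adjoint is the operator \<open>z\<^sub>1 A\<^sub>1\<^sup>* + z\<^sub>2 A\<^sub>2\<^sup>*\<close> of the characteristic function,
  and for \<open>z\<close> in the unit ball both have norm less than \<open>1\<close>.
\<close>

abbreviation pencil where "pencil z1 z2 u \<equiv> A (scalar_col z1 z2 u)"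

lemma clinear_pencil: "bounded_clinear (pencil z1 z2)"
proof -
  have "bounded_clinear (\<lambda>u. A1 (cnj z1 *\<^sub>C u) + A2 (cnj z2 *\<^sub>C u))"
    by (intro bounded_clinear_add bounded_clinear_compose[OF clinear1]
        bounded_clinear_compose[OF clinear2] bounded_clinear_scaleC)
  then show ?thesis
    by (simp add: row_op_def scalar_col_def)
qed

lemma norm_pencil_le: "norm (pencil z1 z2 u) \<le> sqrt ((cmod z1)\<^sup>2 + (cmod z2)\<^sup>2) * norm u"
  using contraction_A[of "scalar_col z1 z2 u"]
  by (simp add: scalar_col_def norm_prod_def norm_scaleC power_mult_distrib real_sqrt_mult
      flip: distrib_right)

lemma cadjoint_pencil:
  "cadjoint (pencil z1 z2) g = z1 *\<^sub>C cadjoint A1 g + z2 *\<^sub>C cadjoint A2 g"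
proof -
  have "inner m (cadjoint (pencil z1 z2) g) = inner m (z1 *\<^sub>C cadjoint A1 g + z2 *\<^sub>C cadjoint A2 g)" for m
  proof -
    have "inner m (cadjoint (pencil z1 z2) g) = inner (A1 (cnj z1 *\<^sub>C m) + A2 (cnj z2 *\<^sub>C m)) g"
      unfolding inner_cadjoint[OF clinear_pencil, symmetric] by (simp add: row_op_def scalar_col_def)
    then show ?thesis
      by (simp add: inner_add_left inner_add_right inner_cadjoint clinear1 clinear2 inner_scaleC_left)
  qed
  then show ?thesis
    by (metis inner_commute vector_eq_rdot)
qed

lemma surj_id_minus_pencil:
  assumes "(z1, z2) \<in> unit_ball2"
  shows "surj (\<lambda>u. u - pencil z1 z2 u)"
    and "surj (\<lambda>g. g - z1 *\<^sub>C cadjoint A1 g - z2 *\<^sub>C cadjoint A2 g)"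
proof -
  let ?c = "sqrt ((cmod z1)\<^sup>2 + (cmod z2)\<^sup>2)"
  have c: "0 \<le> ?c" "?c < 1"
    using assms by (auto simp: unit_ball2_def)
  show "surj (\<lambda>u. u - pencil z1 z2 u)"
    using clinear_pencil norm_pencil_le
    by (intro surj_id_minus_contraction[OF _ c]) (auto simp: bounded_clinear_def)
  have "surj (\<lambda>g. g - cadjoint (pencil z1 z2) g)"
    using bounded_clinear_cadjoint[OF clinear_pencil]
    by (intro surj_id_minus_contraction[OF _ c] norm_cadjoint_le clinear_pencil norm_pencil_le c)
       (auto simp: bounded_clinear_def)
  then show "surj (\<lambda>g. g - z1 *\<^sub>C cadjoint A1 g - z2 *\<^sub>C cadjoint A2 g)"
    by (simp add: cadjoint_pencil diff_diff_eq)
qed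

text \<open>
  The formal adjoint \<open>\<theta>(z)\<^sup>* = -A\<^sup>* + D Z\<^sup>* (1 - A Z\<^sup>*)\<^bsup>-1\<^esup> D\<^sub>*\<close> applied to \<open>D\<^sub>* y\<close>. The relations
  \<open>D\<^sub>*\<^sup>2 = 1 - A A\<^sup>*\<close> and \<open>A\<^sup>* D\<^sub>* = D A\<^sup>*\<close> allow one factor \<open>D\<close> to be pulled out in front; in
  particular the result lies in the range of \<open>D\<close>, inside the defect space.
\<close>

lemma char_fun_adjoint_defect_star:
  assumes z: "(z1, z2) \<in> unit_ball2"
  shows "\<exists>u. u - pencil z1 z2 u = y - A (As y) \<and>
    char_fun_adjoint A1 A2 (z1, z2) (Ds y) = D (scalar_col z1 z2 u - As y)"
proof -
  interpret D: bounded_linear D by (rule bounded_linear_defect)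
  obtain u where u: "u - pencil z1 z2 u = y - A (As y)"
    using surjD[OF surj_id_minus_pencil(1)[OF z], of "y - A (As y)"] by metis
  have "char_fun_adjoint A1 A2 (z1, z2) (Ds y) = D (scalar_col z1 z2 u - As y)"
    unfolding char_fun_adjoint_def
  proof (rule adjoint_on_eqI)
    show "Ds y \<in> defect_star_space A1 A2"
      unfolding defect_star_space_def by (rule closure_subset[THEN subsetD]) simp
    show "D (scalar_col z1 z2 u - As y) \<in> defect_space A1 A2"
      unfolding defect_space_def by (rule closure_subset[THEN subsetD]) simp
  next
    fix h assume h: "h \<in> defect_space A1 A2"
    \<comment> \<open>\<open>g = (1 - Z A\<^sup>*)\<^bsup>-1\<^esup> Z D h\<close> is the vector to which \<open>D\<^sub>*\<close> is applied in \<open>\<theta>(z) h\<close>.\<close>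
    define g where "g = inv (\<lambda>x. x - z1 *\<^sub>C cadjoint A1 x - z2 *\<^sub>C cadjoint A2 x)
      (scalar_row z1 z2 (D h))"
    have g: "g - cadjoint (pencil z1 z2) g = scalar_row z1 z2 (D h)"
      using surj_f_inv_f[OF surj_id_minus_pencil(2)[OF z], of "scalar_row z1 z2 (D h)"]
      by (simp add: g_def cadjoint_pencil diff_diff_eq)
    have "cinner g (Ds (Ds y)) = cinner g u - cinner g (pencil z1 z2 u)"
      by (simp add: defect_star_square u[symmetric] cinner_diff_right)
    also have "\<dots> = cinner (g - cadjoint (pencil z1 z2) g) u"
      using cinner_cadjoint[OF clinear_pencil, of z1 z2 u g]
      by (metis cinner_commute cinner_diff_left)
    also have "\<dots> = cinner h (D (scalar_col z1 z2 u))"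
      by (simp add: g cinner_scalar_row positive_op_cinner[OF positive_op_defect])
    finally have 1: "cinner (Ds g) (Ds y) = cinner h (D (scalar_col z1 z2 u))"
      by (simp add: positive_op_cinner[OF positive_op_defect_star])
    have 2: "cinner (A h) (Ds y) = cinner h (D (As y))"
      by (simp add: cinner_cadjoint[OF clinear_A] adjoint_defect_star)
    have "char_fun A1 A2 (z1, z2) h = Ds g - A h"
      using h by (simp add: char_fun_def g_def)
    then show "cinner (char_fun A1 A2 (z1, z2) h) (Ds y) = cinner h (D (scalar_col z1 z2 u - As y))"
      by (simp add: cinner_diff_left 1 2 D.diff cinner_diff_right)
  qed
  then show ?thesis using u by blast
qed

end

theorem proposition3:
  fixes A1 A2 :: "'a::complex_hilbert_space \<Rightarrow> 'a" and z1 z2 :: complex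
  assumes "commuting_2_contraction A1 A2"
    and "inj (defect_star A1 A2)"
    and "(z1, z2) \<in> unit_ball2"
    and "\<exists>y. y \<noteq> 0 \<and> char_fun_adjoint A1 A2 (z1, z2) (defect_star A1 A2 y) = 0"
  shows "(z1, z2) \<in> sigma_T3 A1 A2"
proof -
  interpret row_contraction A1 A2
    using assms(1) by unfold_locales (auto simp: commuting_2_contraction_def)
  obtain y where "y \<noteq> 0" and y: "char_fun_adjoint A1 A2 (z1, z2) (defect_star A1 A2 y) = 0"
    using assms(4) by blast
  obtain u where u: "u - A (scalar_col z1 z2 u) = y - A (As y)"
    and "char_fun_adjoint A1 A2 (z1, z2) (defect_star A1 A2 y) = defect A1 A2 (scalar_col z1 z2 u - As y)"
    using char_fun_adjoint_defect_star[OF assms(3)] by blast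
  then have "defect A1 A2 (scalar_col z1 z2 u - As y) = 0"
    using y by simp
  then have eq: "scalar_col z1 z2 u = As y"
    using defect_eq_0[OF assms(2), of "scalar_col z1 z2 u - As y"] by simp
  \<comment> \<open>Now \<open>A Z\<^sup>* u = A A\<^sup>* y\<close>, so the equation for \<open>u\<close> reads \<open>u = y\<close>.\<close>
  with u have eq: "scalar_col z1 z2 y = As y"
    by simp
  have "y \<noteq> (A1 x1 - z1 *\<^sub>C x1) - (A2 x2 - z2 *\<^sub>C x2)" for x1 x2
  proof
    assume "y = (A1 x1 - z1 *\<^sub>C x1) - (A2 x2 - z2 *\<^sub>C x2)"
    moreover have "A2 (- x2) = - A2 x2"
      using clinear2 by (simp add: bounded_clinear_def linear_simps)
    ultimately have "y = A (x1, - x2) - scalar_row z1 z2 (x1, - x2)"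
      by (simp add: row_op_def scaleC_minus_right)
    then have "cinner y y = cinner (A (x1, - x2)) y - cinner (scalar_row z1 z2 (x1, - x2)) y"
      by (metis cinner_diff_left)
    also have "\<dots> = 0"
      by (simp add: cinner_cadjoint[OF clinear_A] cinner_scalar_row eq)
    finally show False
      using \<open>y \<noteq> 0\<close> inner_eq_Re_cinner[of y y] by simp
  qed
  then show ?thesis
    unfolding sigma_T3_def by blast
qed

end
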